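(* Let $h$ be an integer-valued function on the positive integers such that every multipartite digraph $D$ with no cyclic triangle satisfies $k(D)\le h(\beta(D))$. Let $g(1)=1$ and, for $\alpha\ge 2$, let $g(\alpha)=g(\alpha-1)+h(\alpha)$. Suppose that the edges of a graph $G$ are colored so that no triangle is colored with three distinct colors. Then the vertices of $G$ can be covered by the vertices of at most $g(\alpha(G))$ monochromatic components. In case $\alpha(G)=2$, at most five monochromatic components are enough.
   Context: Graphs and digraphs are finite, loopless and have at least one vertex; $G$ is a simple undirected graph, not necessarily complete, and $\alpha(G)$ is its independence number. The edge-coloring uses any number of colors. A monochromatic component of an edge-colored graph $G$ is (the vertex set of) a connected component of the spanning subgraph of $G$ formed by all edges of one color; a single vertex is allowed as a monochromatic component. A multipartite digraph is a digraph $D$ whose vertex set is partitioned into classes $A_1,\dots,A_t$ (the partite classes), each of which is an independent set (no edges inside, in either direction). A cyclic triangle consists of three vertices $u,v,w$ with $(u,v),(v,w),(w,u)\in E(D)$. For $S\subseteq\{1,\dots,t\}$, the set $U=\bigcup_{i\in S}A_i$ is called a dominating set of size $|S|$ if for every $v\in\bigcup_{i\notin S}A_i$ there is a $w\in U$ with $(w,v)\in E(D)$. The smallest $|S|$ for which $D$ has a dominating set $\bigcup_{i\in S}A_i$ is denoted by $k(D)$. $\beta(D)$ denotes the cardinality of a largest independent set of $D$ whose vertices are from pairwise different partite classes. A function $h$ with the property required in the claim exists. *)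

theory Defs
  imports "Graph_Theory.Digraph_Component" "HOL-Library.Disjoint_Sets"
begin

text \<open>
  Simple digraphs are \<^locale>\<open>pair_digraph\<close>s (finite, no loops, no parallel arcs; antiparallel
  arcs are allowed) and simple graphs are \<^locale>\<open>pair_graph\<close>s (the symmetric ones). Neither
  locale excludes the null graph, so nonemptiness is always required separately.
\<close>

definition independent_set :: "'a pair_pre_digraph \<Rightarrow> 'a set \<Rightarrow> bool" where
  "independent_set D I \<longleftrightarrow> I \<subseteq> pverts D \<and> (\<forall>u\<in>I. \<forall>v\<in>I. (u, v) \<notin> parcs D)"

definition independence_number :: "'a pair_pre_digraph \<Rightarrow> nat" where
  "independence_number G = Max (card ` {I. independent_set G I})"


section \<open>Multipartite digraphs\<close>

text \<open>
  The set \<open>P\<close> of partite classes is carried along explicitly, since the domination number and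
  \<open>\<beta>\<close> depend on it.
\<close>

definition multipartite_digraph :: "'a pair_pre_digraph \<Rightarrow> 'a set set \<Rightarrow> bool" where
  "multipartite_digraph D P \<longleftrightarrow>
     pair_digraph D \<and> pverts D \<noteq> {} \<and> partition_on (pverts D) P \<and> (\<forall>A\<in>P. independent_set D A)"

definition has_cyclic_triangle :: "'a pair_pre_digraph \<Rightarrow> bool" where
  "has_cyclic_triangle D \<longleftrightarrow>
     (\<exists>u v w. (u, v) \<in> parcs D \<and> (v, w) \<in> parcs D \<and> (w, u) \<in> parcs D)"

definition dominating_classes :: "'a pair_pre_digraph \<Rightarrow> 'a set set \<Rightarrow> 'a set set \<Rightarrow> bool" where
  "dominating_classes D P S \<longleftrightarrow>
     S \<subseteq> P \<and> (\<forall>v\<in>\<Union>(P - S). \<exists>w\<in>\<Union>S. (w, v) \<in> parcs D)"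

definition domination_number :: "'a pair_pre_digraph \<Rightarrow> 'a set set \<Rightarrow> nat" where
  "domination_number D P = (LEAST k. \<exists>S. dominating_classes D P S \<and> card S = k)"

definition transversal_independent :: "'a pair_pre_digraph \<Rightarrow> 'a set set \<Rightarrow> 'a set \<Rightarrow> bool" where
  "transversal_independent D P I \<longleftrightarrow>
     independent_set D I \<and> (\<forall>A\<in>P. \<forall>u\<in>I \<inter> A. \<forall>v\<in>I \<inter> A. u = v)"

definition transversal_independence_number :: "'a pair_pre_digraph \<Rightarrow> 'a set set \<Rightarrow> nat" where
  "transversal_independence_number D P = Max (card ` {I. transversal_independent D P I})"


section \<open>Edge colorings\<close>

text \<open>
  An edge coloring is a function \<open>col\<close> on unordered pairs; only its values on edges of the graph
  matter. Every element of the type of colors counts as a color, used or not.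
\<close>

definition no_rainbow_triangle :: "'a pair_pre_digraph \<Rightarrow> ('a set \<Rightarrow> 'c) \<Rightarrow> bool" where
  "no_rainbow_triangle G col \<longleftrightarrow>
     (\<forall>u v w. (u, v) \<in> parcs G \<and> (v, w) \<in> parcs G \<and> (u, w) \<in> parcs G \<longrightarrow>
        \<not> (col {u, v} \<noteq> col {v, w} \<and> col {v, w} \<noteq> col {u, w} \<and> col {u, v} \<noteq> col {u, w}))"

definition color_subgraph ::
    "'a pair_pre_digraph \<Rightarrow> ('a set \<Rightarrow> 'c) \<Rightarrow> 'c \<Rightarrow> 'a pair_pre_digraph" where
  "color_subgraph G col c =
     \<lparr> pverts = pverts G, parcs = {(u, v). (u, v) \<in> parcs G \<and> col {u, v} = c} \<rparr>"

text \<open>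
  A color subgraph of a \<^locale>\<open>pair_graph\<close> is symmetric, so its strongly connected components are
  its connected components. Vertices isolated in it form singleton components.
\<close>

definition monochromatic_components ::
    "'a pair_pre_digraph \<Rightarrow> ('a set \<Rightarrow> 'c) \<Rightarrow> 'a set set" where
  "monochromatic_components G col =
     (\<Union>c. pre_digraph.sccs_verts (with_proj (color_subgraph G col c)))"

definition monochromatic_cover ::
    "'a pair_pre_digraph \<Rightarrow> ('a set \<Rightarrow> 'c) \<Rightarrow> 'a set set \<Rightarrow> bool" where
  "monochromatic_cover G col \<C> \<longleftrightarrow>
     finite \<C> \<and> \<C> \<subseteq> monochromatic_components G col \<and> pverts G \<subseteq> \<Union>\<C>"

end

theory Submission
  imports Defs
begin

text \<open>
  Fix a vertex \<open>v\<close> of \<open>G\<close> and group its neighbours by the color of their edge to \<open>v\<close>. An edge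
  \<open>xy\<close> between two groups lies in a triangle with \<open>v\<close>, so it has the color of \<open>vx\<close> or of \<open>vy\<close>;
  direct it from \<open>x\<close> to \<open>y\<close> if it has the color of \<open>vx\<close>. This is a multipartite digraph with the
  colors as classes. A cyclic triangle in it would be a rainbow triangle of \<open>G\<close>, and a transversal
  independent set of it is independent in \<open>G\<close>. If \<open>x \<rightarrow> y\<close>, the monochromatic component of \<open>v\<close> in the
  color of \<open>vx\<close> contains \<open>x\<close> and then \<open>y\<close>. So, if some classes dominate, the components of \<open>v\<close> in
  those colors cover \<open>v\<close> and all its neighbours. The non-neighbours of \<open>v\<close> have independence number at
  most \<open>\<alpha> - 1\<close>, and induction on \<open>\<alpha>\<close> yields the recursion for \<open>g\<close>
  (\<open>coverable_via_star\<close>, \<open>coverable_by_recursion\<close>).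

  Since \<open>h\<close> may fail to be monotone, a difficulty is that the digraph at \<open>v\<close> may have \<open>\<beta> < \<alpha>\<close>. Adding
  \<open>\<alpha> - \<beta>\<close> isolated vertices, each forming a class of its own, raises \<open>\<beta>\<close> to exactly \<open>\<alpha>\<close> and does
  not make domination easier; so \<open>h \<alpha>\<close> classes suffice (\<open>dominating_classes_of_bound\<close>). The padded
  digraph has a vertex, hence also \<open>1 \<le> h \<alpha>\<close>.

  The value \<open>g 1 = 1\<close> and the bound five call for explicit values in place of \<open>h\<close>: one class
  dominates if \<open>\<beta> \<le> 1\<close> (\<open>semicomplete_dominating_class\<close>) and four classes dominate if \<open>\<beta> \<le> 2\<close>
  (\<open>four_dominating_classes\<close>), the fifth component covering the clique of non-neighbours of
  \<open>v\<close>. Both are extremal arguments. For the second, let \<open>a\<close> have as few strict in-neighbours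
  as possible. A strict in-neighbour \<open>b\<close> of \<open>a\<close> not dominated by the class of \<open>a\<close> must then
  have an in-neighbour among the vertices nonadjacent to \<open>a\<close> outside its class. These form a
  semicomplete digraph, in which one vertex \<open>t\<close> dominates everything outside its own class and
  one further class. So \<open>t \<rightarrow> x \<rightarrow> b\<close> for some \<open>x\<close>, unless \<open>b\<close> is dominated by one of these
  three classes; as \<open>t x b\<close> is not cyclic, what is not yet dominated is nonadjacent to \<open>t\<close>,
  hence semicomplete, and a fourth class dominates it.
\<close>

section \<open>Multipartite digraphs without cyclic triangles\<close>

text \<open>
  The partite classes are the fibres of \<open>cl\<close>. With \<open>E\<close> and \<open>cl\<close> global and the vertex set \<open>V\<close> a
  parameter, passing to an induced subdigraph only means changing \<open>V\<close>.
\<close>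

locale triangle_free_multipartite =
  fixes E :: "'a \<Rightarrow> 'a \<Rightarrow> bool" and cl :: "'a \<Rightarrow> 'b"
  assumes cl_neq: "E x y \<Longrightarrow> cl x \<noteq> cl y"
    and no_cycle: "E x y \<Longrightarrow> E y z \<Longrightarrow> \<not> E z x"
begin

definition dominates :: "'a set \<Rightarrow> 'b set \<Rightarrow> bool" where
  "dominates V S \<longleftrightarrow> S \<subseteq> cl ` V \<and> (\<forall>y\<in>V. cl y \<in> S \<or> (\<exists>x\<in>V. cl x \<in> S \<and> E x y))"

definition semicomplete :: "'a set \<Rightarrow> bool" where
  "semicomplete V \<longleftrightarrow> (\<forall>x\<in>V. \<forall>y\<in>V. cl x \<noteq> cl y \<longrightarrow> E x y \<or> E y x)"

definition transversal_bound :: "'a set \<Rightarrow> nat \<Rightarrow> bool" where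
  "transversal_bound V n \<longleftrightarrow>
     (\<forall>I\<subseteq>V. inj_on cl I \<longrightarrow> (\<forall>x\<in>I. \<forall>y\<in>I. \<not> E x y) \<longrightarrow> card I \<le> n)"

text \<open>
  Choose the class that dominates the largest set \<open>M\<close>, counting its own vertices. If it missed \<open>y\<close>,
  then \<open>y\<close> would have arcs to the whole class, and, by the absence of cyclic triangles, the class
  of \<open>y\<close> would dominate all of \<open>M\<close> and also \<open>y\<close>.
\<close>

lemma semicomplete_dominating_class:
  assumes "finite V" "V \<noteq> {}" and sc: "semicomplete V"
  obtains t where "t \<in> V" "dominates V {cl t}"
proof -
  define M where "M t = {y \<in> V. cl y = cl t \<or> (\<exists>x\<in>V. cl x = cl t \<and> E x y)}" for t
  have fin: "finite (M t)" for t
    using assms(1) by (simp add: M_def)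
  obtain t where t: "t \<in> V" and max: "\<And>y. y \<in> V \<Longrightarrow> card (M y) \<le> card (M t)"
    using Max_in[of "(\<lambda>t. card (M t)) ` V"] Max_ge[of "(\<lambda>t. card (M t)) ` V"] assms(1,2)
    by (smt (verit) finite_imageI image_iff image_is_empty)
  have "y \<in> M t" if y: "y \<in> V" for y
  proof (rule ccontr)
    assume n: "y \<notin> M t"
    have "M t \<subseteq> M y"
    proof
      fix x assume x: "x \<in> M t"
      have yt: "E y x'" if "x' \<in> V" "cl x' = cl t" for x'
        using that n y sc unfolding M_def semicomplete_def
        by (metis (mono_tags, lifting) mem_Collect_eq)
      show "x \<in> M y"
      proof (cases "cl x = cl t \<or> cl x = cl y")
        case True
        then show ?thesis using x y yt unfolding M_def by auto
      next
        case False
        then obtain x' where x': "x' \<in> V" "cl x' = cl t" "E x' x"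
          using x unfolding M_def by auto
        have "\<not> E x y"
          using no_cycle[OF yt[OF x'(1,2)] x'(3)] .
        then show ?thesis
          using False sc x y unfolding M_def semicomplete_def by auto
      qed
    qed
    moreover have "y \<in> M y" using y by (simp add: M_def)
    ultimately have "card (M t) < card (M y)"
      using n fin by (intro psubset_card_mono) auto
    with max[OF y] show False by simp
  qed
  then have "dominates V {cl t}"
    using t unfolding dominates_def M_def by auto
  with t that show ?thesis by blast
qed

text \<open>
  In the dominating class choose the vertex \<open>t\<close> of maximal out-degree. A vertex \<open>y\<close> it misses has an
  arc to \<open>t\<close> and receives one from some \<open>t'\<close> in the class of \<open>t\<close>. By maximality there is a \<open>q\<close> with
  \<open>t \<rightarrow> q \<rightarrow> t'\<close>, so \<open>t q t' y\<close> is a directed 4-cycle. Any arc between \<open>q\<close> and \<open>y\<close> would close a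
  cyclic triangle, so \<open>q\<close> and \<open>y\<close> are in the same class. Two missed vertices of different classes
  would be joined by an arc \<open>y \<rightarrow> z\<close>; then \<open>t' \<rightarrow> z\<close> as well, so \<open>q\<close> would be in the class of both.
\<close>

lemma semicomplete_vertex_and_class:
  assumes "finite V" "V \<noteq> {}" and sc: "semicomplete V"
  obtains t p where "t \<in> V" "\<And>y. y \<in> V \<Longrightarrow> cl y = cl t \<or> cl y = p \<or> E t y"
proof -
  obtain t0 where t0: "t0 \<in> V" "dominates V {cl t0}"
    using semicomplete_dominating_class[OF assms] .
  define T where "T = {t \<in> V. cl t = cl t0}"
  define Out where "Out t = {y \<in> V. E t y}" for t
  have fin: "finite (Out t)" "finite T" "T \<noteq> {}" for t
    using assms(1) t0 by (auto simp: Out_def T_def)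
  obtain t where t: "t \<in> T" and max: "\<And>y. y \<in> T \<Longrightarrow> card (Out y) \<le> card (Out t)"
    using Max_in[of "(\<lambda>t. card (Out t)) ` T"] Max_ge[of "(\<lambda>t. card (Out t)) ` T"] fin(2,3)
    by (smt (verit) finite_imageI image_iff image_is_empty)
  define R where "R = {y \<in> V. cl y \<noteq> cl t \<and> \<not> E t y}"
  have into_t: "E y t" if "y \<in> R" for y
    using that sc t unfolding R_def semicomplete_def T_def
    by (metis (mono_tags, lifting) mem_Collect_eq)
  have dom: "\<exists>t'\<in>T. E t' y" if "y \<in> R" for y
    using that t0(2) t unfolding dominates_def R_def T_def by auto
  have T_arc: "E t' y \<or> E y t'" if "t' \<in> T" "y \<in> R" for t' y
    using that sc t unfolding R_def semicomplete_def T_def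
    by (metis (mono_tags, lifting) mem_Collect_eq)
  have detour: "\<exists>q\<in>V. E t q \<and> E q t'" if t': "t' \<in> T" "y \<in> R" "E t' y" for t' y
  proof -
    have "y \<in> Out t'" "y \<notin> Out t"
      using that by (auto simp: Out_def R_def)
    then have "\<not> Out t \<subseteq> Out t'"
      using max[OF t'(1)] psubset_card_mono[OF fin(1), of "Out t" t'] by auto
    then obtain q where "q \<in> V" "E t q" "\<not> E t' q" by (auto simp: Out_def)
    moreover have "cl q \<noteq> cl t'"
      using cl_neq[OF \<open>E t q\<close>] t t'(1) by (simp add: T_def)
    ultimately show ?thesis
      using sc t'(1) unfolding semicomplete_def T_def
      by (metis (mono_tags, lifting) mem_Collect_eq)
  qed
  have same: "cl q = cl y" if "q \<in> V" "E t q" "E q t'" "y \<in> R" "E t' y" for q y t'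
  proof (rule ccontr)
    assume "cl q \<noteq> cl y"
    then have "E q y \<or> E y q"
      using that sc by (auto simp: semicomplete_def R_def)
    then show False
      using no_cycle[OF _ into_t[OF that(4)]] no_cycle[OF that(5)] that(2,3) by blast
  qed
  have one: "cl y = cl z" if yz: "y \<in> R" "z \<in> R" "E y z" for y z
  proof -
    obtain t' where t': "t' \<in> T" "E t' y" using dom[OF yz(1)] by blast
    then have "E t' z" using T_arc[OF _ yz(2)] no_cycle[OF t'(2) yz(3)] by blast
    obtain q where "q \<in> V" "E t q" "E q t'" using detour[OF t'(1) yz(1) t'(2)] by blast
    then show ?thesis
      using same yz t'(2) \<open>E t' z\<close> by metis
  qed
  have R_one: "cl y = cl z" if "y \<in> R" "z \<in> R" for y z
    using one[OF that] one[OF that(2,1)] sc that unfolding R_def semicomplete_def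
    by (metis (mono_tags, lifting) mem_Collect_eq)
  have "\<exists>p. \<forall>y\<in>V. cl y = cl t \<or> cl y = p \<or> E t y"
    using R_one unfolding R_def by blast
  moreover have "t \<in> V" using t by (simp add: T_def)
  ultimately show ?thesis using that by blast
qed

lemma semicomplete_if_transversal_bound_1:
  assumes "transversal_bound V 1"
  shows "semicomplete V"
  unfolding semicomplete_def
proof (intro ballI impI)
  fix x y assume xy: "x \<in> V" "y \<in> V" "cl x \<noteq> cl y"
  show "E x y \<or> E y x"
  proof (rule ccontr)
    assume "\<not> ?thesis"
    moreover have "\<not> E u u" for u using cl_neq by blast
    ultimately have "\<forall>u\<in>{x, y}. \<forall>w\<in>{x, y}. \<not> E u w" by blast
    moreover have "inj_on cl {x, y}" "{x, y} \<subseteq> V" using xy by (auto simp: inj_on_def)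
    ultimately have "card {x, y} \<le> 1"
      using assms unfolding transversal_bound_def by blast
    then show False using xy(3) by (auto simp: card_insert_if split: if_splits)
  qed
qed

lemma semicomplete_nonneighbours:
  assumes "transversal_bound V 2" "t \<in> V" "X \<subseteq> V"
    and non: "\<And>x. x \<in> X \<Longrightarrow> cl x \<noteq> cl t \<and> \<not> E x t \<and> \<not> E t x"
  shows "semicomplete X"
  unfolding semicomplete_def
proof (intro ballI impI)
  fix x y assume xy: "x \<in> X" "y \<in> X" "cl x \<noteq> cl y"
  show "E x y \<or> E y x"
  proof (rule ccontr)
    assume "\<not> ?thesis"
    moreover have "\<not> E u u" for u using cl_neq by blast
    ultimately have "\<forall>u\<in>{t, x, y}. \<forall>w\<in>{t, x, y}. \<not> E u w"
      using non[OF xy(1)] non[OF xy(2)] by blast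
    moreover have "inj_on cl {t, x, y}" "{t, x, y} \<subseteq> V"
      using non[OF xy(1)] non[OF xy(2)] xy assms(2,3) by (auto simp: inj_on_def)
    ultimately have "card {t, x, y} \<le> 2"
      using assms(1) unfolding transversal_bound_def by blast
    moreover have "t \<noteq> x" "t \<noteq> y" "x \<noteq> y" using non[OF xy(1)] non[OF xy(2)] xy(3) by auto
    ultimately show False by auto
  qed
qed

text \<open>
  The four classes are those of \<open>a\<close>, which has the fewest strict in-neighbours; of \<open>t\<close>, which
  nearly dominates the vertices \<open>N\<close> nonadjacent to \<open>a\<close>; the class \<open>p\<close> that \<open>t\<close> misses in \<open>N\<close>; and
  a class dominating the remaining vertices \<open>X\<close>, all of which are nonadjacent to \<open>t\<close>.
\<close>

lemma four_dominating_classes: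
  assumes fin: "finite V" and bound: "transversal_bound V 2"
  obtains S where "dominates V S" "card S \<le> 4"
proof (cases "V = {}")
  case True
  then have "dominates V {}" by (simp add: dominates_def)
  then show ?thesis using that by simp
next
  case False
  define In where "In a = {x \<in> V. E x a \<and> \<not> E a x}" for a
  have "\<exists>a. is_arg_min (\<lambda>a. card (In a)) (\<lambda>a. a \<in> V) a"
    using ex_is_arg_min_if_finite[OF fin False] .
  then obtain a where a: "a \<in> V" and min: "\<And>b. b \<in> V \<Longrightarrow> card (In a) \<le> card (In b)"
    by (auto simp: is_arg_min_linorder)
  define N where "N = {x \<in> V. cl x \<noteq> cl a \<and> \<not> E a x \<and> \<not> E x a}"
  have N: "finite N" "N \<subseteq> V" using fin by (auto simp: N_def)
  have N_sc: "semicomplete N"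
    by (rule semicomplete_nonneighbours[OF bound a N(2)]) (simp add: N_def)
  have via_N: "(\<exists>x\<in>V. cl x = cl a \<and> E x b) \<or> (\<exists>x\<in>N. E x b)" if b: "b \<in> In a" for b
  proof -
    have "b \<in> V" "E b a" using b by (auto simp: In_def)
    have "b \<notin> In b" using cl_neq by (auto simp: In_def)
    moreover have "finite (In a)" using fin by (simp add: In_def)
    \<comment> \<open>Otherwise \<open>In b\<close> would be a proper subset of \<open>In a\<close>, against the minimality of \<open>a\<close>.
      An \<open>x\<close> in the difference has no arc from \<open>a\<close>, as \<open>a x b\<close> would be cyclic; so, not being in
      \<open>In a\<close>, it has none to \<open>a\<close> either.\<close>
    ultimately have "\<not> In b \<subseteq> In a"
      using min[OF \<open>b \<in> V\<close>] b card_seteq by blast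
    then obtain x where x: "x \<in> V" "E x b" "x \<notin> In a" by (auto simp: In_def)
    then have "\<not> E a x" using no_cycle[OF x(2) \<open>E b a\<close>] by blast
    then show ?thesis using x by (auto simp: In_def N_def)
  qed
  have cases_V: "cl x = cl a \<or> E a x \<or> x \<in> In a \<or> x \<in> N" if "x \<in> V" for x
    using that by (auto simp: In_def N_def)
  show ?thesis
  proof (cases "N = {}")
    case True
    then have "dominates V {cl a}"
      using a cases_V via_N unfolding dominates_def by fastforce
    then show ?thesis using that by simp
  next
    case False
    obtain t p where t: "t \<in> N" and p: "\<And>y. y \<in> N \<Longrightarrow> cl y = cl t \<or> cl y = p \<or> E t y"
      using semicomplete_vertex_and_class[OF N(1) False N_sc] by blast
    \<comment> \<open>\<open>p\<close> may be an arbitrary value, not the class of any vertex, hence the intersection.\<close>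
    define S where "S = {cl a, cl t, p} \<inter> cl ` V"
    have S: "card S \<le> 3"
    proof -
      have "card S \<le> card {cl a, cl t, p}" unfolding S_def by (intro card_mono) auto
      also have "\<dots> \<le> 3" by (simp add: card_insert_if)
      finally show ?thesis .
    qed
    have finS: "finite S" by (simp add: S_def)
    define X where "X = {y \<in> V. cl y \<notin> S \<and> (\<forall>x\<in>V. cl x \<in> S \<longrightarrow> \<not> E x y)}"
    have tV: "t \<in> V" and S_in: "cl a \<in> S" "cl t \<in> S" using t N(2) a by (auto simp: S_def)
    have p_in: "cl y \<in> S" if "y \<in> V" "cl y = p" for y using that by (auto simp: S_def)
    have X_non: "cl y \<noteq> cl t \<and> \<not> E y t \<and> \<not> E t y" if y: "y \<in> X" for y
    proof -
      have yV: "y \<in> V" and 1: "cl y \<notin> S" and 2: "\<And>x. x \<in> V \<Longrightarrow> cl x \<in> S \<Longrightarrow> \<not> E x y"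
        using y by (auto simp: X_def)
      have "y \<notin> N" using p[of y] 1 2[OF tV] S_in p_in[OF yV] by auto
      then have "y \<in> In a" using cases_V[OF yV] 1 S_in 2[OF a] by auto
      then obtain x where x: "x \<in> N" "E x y" using via_N 2 S_in by metis
      then have "cl x \<notin> S" using 2 N(2) by auto
      then have "E t x" using p[OF x(1)] S_in p_in[of x] x N(2) by auto
      then have "\<not> E y t" using no_cycle[OF \<open>E t x\<close> x(2)] by blast
      then show ?thesis using 1 2[OF tV] S_in by auto
    qed
    have "X \<subseteq> V" by (auto simp: X_def)
    then have X: "semicomplete X" "finite X"
      using semicomplete_nonneighbours[OF bound tV] X_non fin finite_subset by blast+
    show ?thesis
    proof (cases "X = {}")
      case True
      then have "dominates V S" by (auto simp: dominates_def X_def S_def)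
      then show ?thesis using that S by simp
    next
      case False
      obtain s where s: "s \<in> X" "dominates X {cl s}"
        using semicomplete_dominating_class[OF X(2) False X(1)] .
      have "dominates V (insert (cl s) S)"
        unfolding dominates_def
      proof (intro conjI ballI)
        show "insert (cl s) S \<subseteq> cl ` V" using s by (auto simp: S_def X_def)
        fix y assume "y \<in> V"
        show "cl y \<in> insert (cl s) S \<or> (\<exists>x\<in>V. cl x \<in> insert (cl s) S \<and> E x y)"
        proof (cases "y \<in> X")
          case True
          then have "cl y = cl s \<or> (\<exists>x\<in>X. cl x = cl s \<and> E x y)"
            using s(2) by (auto simp: dominates_def)
          then show ?thesis by (auto simp: X_def)
        qed (use \<open>y \<in> V\<close> in \<open>auto simp: X_def\<close>)
      qed
      moreover have "card (insert (cl s) S) \<le> 4"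
        using S finS by (simp add: card_insert_if)
      ultimately show ?thesis using that by blast
    qed
  qed
qed

section \<open>Domination bounded by \<open>h\<close>\<close>

text \<open>
  The bound \<open>h\<close> is given for digraphs on natural numbers with an explicit set of partite classes.
  An injective numbering \<open>f\<close> of \<open>V\<close> turns the fibre of \<open>c\<close> into the class \<open>K c\<close>, and the
  dominating set of classes found there is pulled back along \<open>K\<close>. The independent set \<open>I\<close> ensures
  that \<open>\<beta>\<close> is exactly \<open>n\<close>.
\<close>

lemma dominating_classes_of_tight_bound:
  fixes h :: "nat \<Rightarrow> int"
  assumes h: "\<And>(D :: nat pair_pre_digraph) P.
      multipartite_digraph D P \<Longrightarrow> \<not> has_cyclic_triangle D \<Longrightarrow>
      int (domination_number D P) \<le> h (transversal_independence_number D P)"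
    and fin: "finite V" and ne: "V \<noteq> {}" and bound: "transversal_bound V n"
    and I: "I \<subseteq> V" "inj_on cl I" "\<forall>x\<in>I. \<forall>y\<in>I. \<not> E x y" "card I = n"
  obtains S where "dominates V S" "int (card S) \<le> h n"
proof -
  obtain f :: "'a \<Rightarrow> nat" where f: "inj_on f V"
    using finite_imp_inj_to_nat_seg[OF fin] by blast
  define D where "D = \<lparr>pverts = f ` V, parcs = {(f x, f y) | x y. x \<in> V \<and> y \<in> V \<and> E x y}\<rparr>"
  define K where "K c = f ` {x \<in> V. cl x = c}" for c
  define P where "P = K ` cl ` V"
  have arc: "(f x, f y) \<in> parcs D \<longleftrightarrow> E x y" if "x \<in> V" "y \<in> V" for x y
    using that f unfolding D_def by (auto simp: inj_on_def)
  have arcE: "\<exists>x\<in>V. \<exists>y\<in>V. a = f x \<and> b = f y \<and> E x y" if "(a, b) \<in> parcs D" for a b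
    using that unfolding D_def by auto
  have fK: "f x \<in> K c \<longleftrightarrow> cl x = c" if "x \<in> V" for x c
    using that f unfolding K_def by (auto simp: inj_on_def)
  have "pair_digraph D"
  proof
    have "parcs D \<subseteq> (f ` V) \<times> (f ` V)" by (auto simp: D_def)
    then show "finite (parcs D)" using fin finite_subset by blast
    show "finite (pverts D)" using fin by (simp add: D_def)
    fix e assume e: "e \<in> parcs D"
    then show "fst e \<in> pverts D" "snd e \<in> pverts D" by (auto simp: D_def)
    obtain x y where "x \<in> V" "y \<in> V" "fst e = f x" "snd e = f y" "E x y"
      using arcE[of "fst e" "snd e"] e by auto
    then show "fst e \<noteq> snd e" using f cl_neq by (auto simp: inj_on_def)
  qed
  moreover have "partition_on (pverts D) P"
  proof (rule partition_onI)
    show "\<Union>P = pverts D" by (auto simp: D_def P_def K_def)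
    show "{} \<notin> P" by (auto simp: P_def K_def)
    fix A B assume AB: "A \<in> P" "B \<in> P" "A \<noteq> B"
    then obtain c d where cd: "A = K c" "B = K d" unfolding P_def by blast
    with AB(3) have "c \<noteq> d" by blast
    have False if "a \<in> K c" "a \<in> K d" for a
    proof -
      obtain x where "x \<in> V" "a = f x" using \<open>a \<in> K c\<close> by (auto simp: K_def)
      then show False using that fK \<open>c \<noteq> d\<close> by simp
    qed
    then show "disjnt A B" by (auto simp: cd disjnt_def)
  qed
  moreover have "independent_set D A" if A: "A \<in> P" for A
  proof -
    obtain c where c: "A = K c" using A unfolding P_def by blast
    have "\<not> E x y" if "cl x = c" "cl y = c" for x y using that cl_neq[of x y] by auto
    then show ?thesis unfolding c independent_set_def
      by (auto simp: K_def arc) (auto simp: D_def)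
  qed
  ultimately have multi: "multipartite_digraph D P"
    using ne by (auto simp: multipartite_digraph_def D_def)
  have "\<not> has_cyclic_triangle D"
  proof
    assume "has_cyclic_triangle D"
    then obtain u v w where uvw: "(u, v) \<in> parcs D" "(v, w) \<in> parcs D" "(w, u) \<in> parcs D"
      by (auto simp: has_cyclic_triangle_def)
    then obtain x y z where "x \<in> V" "y \<in> V" "z \<in> V" "u = f x" "v = f y" "w = f z"
      using arcE by metis
    with uvw show False using no_cycle[of x y z] by (simp add: arc)
  qed
  note hD = h[OF multi this]
  have indep: "transversal_independent D P (f ` J) \<longleftrightarrow>
      inj_on cl J \<and> (\<forall>x\<in>J. \<forall>y\<in>J. \<not> E x y)" if J: "J \<subseteq> V" for J
  proof -
    have "independent_set D (f ` J) \<longleftrightarrow> (\<forall>x\<in>J. \<forall>y\<in>J. \<not> E x y)"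
    proof -
      have "f ` J \<subseteq> pverts D" using J by (auto simp: D_def)
      moreover have "(f x, f y) \<in> parcs D \<longleftrightarrow> E x y" if "x \<in> J" "y \<in> J" for x y
        using arc J that by blast
      ultimately show ?thesis by (simp add: independent_set_def)
    qed
    moreover have "(\<forall>A\<in>P. \<forall>u\<in>f ` J \<inter> A. \<forall>v\<in>f ` J \<inter> A. u = v) \<longleftrightarrow>
        (\<forall>x\<in>J. \<forall>y\<in>J. cl x = cl y \<longrightarrow> f x = f y)"
    proof -
      have "(\<exists>A\<in>P. f x \<in> A \<and> f y \<in> A) \<longleftrightarrow> cl x = cl y" if "x \<in> J" "y \<in> J" for x y
      proof -
        have V: "x \<in> V" "y \<in> V" using that J by auto
        then show ?thesis unfolding P_def by (auto simp: fK[OF V(1)] fK[OF V(2)])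
      qed
      then show ?thesis by blast
    qed
    moreover have "f x = f y \<longleftrightarrow> x = y" if "x \<in> J" "y \<in> J" for x y
      using that J f by (auto simp: inj_on_def)
    ultimately show ?thesis unfolding transversal_independent_def inj_on_def by auto
  qed
  have "transversal_independence_number D P = n"
    unfolding transversal_independence_number_def
  proof (rule Max_eqI)
    have "{I. transversal_independent D P I} \<subseteq> Pow (f ` V)"
      by (auto simp: transversal_independent_def independent_set_def D_def)
    then show "finite (card ` {I. transversal_independent D P I})"
      using fin by (meson finite_Pow_iff finite_imageI finite_subset)
    have "card (f ` I) = n" using I f by (metis card_image inj_on_subset)
    then show "n \<in> card ` {I. transversal_independent D P I}"
      using indep[OF I(1)] I by (metis (mono_tags, lifting) imageI mem_Collect_eq)
    fix m assume "m \<in> card ` {I. transversal_independent D P I}"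
    then obtain L where L: "transversal_independent D P L" "m = card L" by auto
    then have "L \<subseteq> f ` V" by (auto simp: transversal_independent_def independent_set_def D_def)
    then obtain J where J: "J \<subseteq> V" "L = f ` J" by (auto simp: subset_image_iff)
    then have "card J \<le> n" using L indep bound by (auto simp: transversal_bound_def)
    then show "m \<le> n" using L(2) J fin card_image_le finite_subset le_trans by metis
  qed
  with hD have hn: "int (domination_number D P) \<le> h n" by simp
  have "dominating_classes D P P" by (auto simp: dominating_classes_def)
  then have "\<exists>k S. dominating_classes D P S \<and> card S = k" by blast
  then obtain T where T: "dominating_classes D P T" "card T = domination_number D P"
    unfolding domination_number_def
    using LeastI_ex[of "\<lambda>k. \<exists>S. dominating_classes D P S \<and> card S = k"] by blast
  define S where "S = {c \<in> cl ` V. K c \<in> T}"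
  have "inj_on K S"
  proof (rule inj_onI)
    fix c d assume "c \<in> S" "d \<in> S" "K c = K d"
    then show "c = d" using fK unfolding S_def by blast
  qed
  moreover have "finite T"
    using T(1) fin by (auto simp: dominating_classes_def P_def intro: finite_subset)
  ultimately have "card S \<le> card T"
    by (intro card_inj_on_le[of K]) (auto simp: S_def)
  moreover have "dominates V S"
    unfolding dominates_def
  proof (intro conjI ballI)
    show "S \<subseteq> cl ` V" by (auto simp: S_def)
    fix y assume y: "y \<in> V"
    show "cl y \<in> S \<or> (\<exists>x\<in>V. cl x \<in> S \<and> E x y)"
    proof (cases "cl y \<in> S")
      case False
      then have "K (cl y) \<in> P - T" using y by (auto simp: S_def P_def)
      moreover have "f y \<in> K (cl y)" using fK[OF y] by simp
      ultimately obtain w where w: "w \<in> \<Union>T" "(w, f y) \<in> parcs D"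
        using T(1) unfolding dominating_classes_def by blast
      then obtain x where x: "x \<in> V" "w = f x" "E x y"
        using arcE[OF w(2)] f y by (auto simp: inj_on_def)
      obtain c where c: "K c \<in> T" "f x \<in> K c" "c \<in> cl ` V"
        using w(1) x(2) T(1) by (auto simp: dominating_classes_def P_def)
      then have "cl x \<in> S" using fK[OF x(1)] by (auto simp: S_def)
      then show ?thesis using x by blast
    qed simp
  qed
  ultimately show ?thesis using that T(2) hn by (metis of_nat_mono order_trans)
qed

end

text \<open>
  Padding with isolated vertices makes \<open>n\<close> the exact value of \<open>\<beta>\<close>, so that the bound is \<open>h n\<close>
  even if \<open>h\<close> decreases somewhere. They send out no arcs, hence do not interfere with domination in \<open>V\<close>, and
  deleting their classes from a dominating set leaves one for \<open>V\<close>. The maximum with \<open>1\<close> matters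
  when \<open>V\<close> is empty: the padded digraph still has a vertex.
\<close>

lemma dominating_classes_of_bound:
  fixes h :: "nat \<Rightarrow> int" and E :: "'a \<Rightarrow> 'a \<Rightarrow> bool" and cl :: "'a \<Rightarrow> 'b"
  assumes tf: "triangle_free_multipartite E cl"
    and h: "\<And>(D :: nat pair_pre_digraph) P.
      multipartite_digraph D P \<Longrightarrow> \<not> has_cyclic_triangle D \<Longrightarrow>
      int (domination_number D P) \<le> h (transversal_independence_number D P)"
    and fin: "finite V" and n: "n \<ge> 1"
    and bound: "triangle_free_multipartite.transversal_bound E cl V n"
  obtains S where "triangle_free_multipartite.dominates E cl V S"
    "max 1 (int (card S)) \<le> h n"
proof -
  interpret triangle_free_multipartite E cl by fact
  define good where "good I \<longleftrightarrow> I \<subseteq> V \<and> inj_on cl I \<and> (\<forall>x\<in>I. \<forall>y\<in>I. \<not> E x y)" for I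
  have good_le: "card I \<le> n" if "good I" for I
    using that bound by (auto simp: good_def transversal_bound_def)
  have "finite {I. good I}" using fin by (auto simp: good_def intro: finite_subset[of _ "Pow V"])
  moreover have "good {}" by (simp add: good_def)
  ultimately obtain I where I: "good I" and I_max: "\<And>J. good J \<Longrightarrow> card J \<le> card I"
    using Max_in[of "card ` {I. good I}"] Max_ge[of "card ` {I. good I}"]
    by (smt (verit) empty_iff finite_imageI image_iff image_is_empty mem_Collect_eq)
  define k where "k = n - card I"
  define E' where "E' = rel_sum E (\<lambda>(_::nat) (_::nat). False)"
  define cl' where "cl' = (map_sum cl id :: 'a + nat \<Rightarrow> 'b + nat)"
  define V' where "V' = V <+> {..<k}"
  have E': "E' u w \<longleftrightarrow> (\<exists>x y. u = Inl x \<and> w = Inl y \<and> E x y)" for u w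
    by (auto simp: E'_def elim: rel_sum.cases)
  interpret pad: triangle_free_multipartite E' cl'
    by unfold_locales (auto simp: E' cl'_def dest: cl_neq no_cycle)
  have split: "X = Inl ` (Inl -` X) \<union> Inr ` (Inr -` X)" for X :: "('a + nat) set"
    by (auto, metis (no_types) obj_sumE rangeI image_eqI vimageI)
  have card_split: "card (Inl ` A \<union> Inr ` B) = card A + card B" if "finite A" "finite B"
    for A :: "'a set" and B :: "nat set"
    using that by (subst card_Un_disjoint) (auto simp: card_image)
  have pad_bound: "pad.transversal_bound V' n"
    unfolding pad.transversal_bound_def
  proof (intro allI impI)
    fix X assume X: "X \<subseteq> V'" "inj_on cl' X" "\<forall>x\<in>X. \<forall>y\<in>X. \<not> E' x y"
    have "inj_on cl (Inl -` X)"
    proof (rule inj_onI)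
      fix x y assume xy: "x \<in> Inl -` X" "y \<in> Inl -` X" "cl x = cl y"
      then have "cl' (Inl x) = cl' (Inl y)" by (simp add: cl'_def)
      then show "x = y" using xy X(2) by (auto dest: inj_onD)
    qed
    then have gJ: "good (Inl -` X)" using X by (auto simp: good_def E' V'_def)
    have r: "Inr -` X \<subseteq> {..<k}" using X(1) by (auto simp: V'_def)
    have "card X = card (Inl -` X) + card (Inr -` X)"
      using card_split[of "Inl -` X" "Inr -` X"] split[of X] gJ fin r
      by (metis finite_lessThan finite_subset good_def)
    also have "\<dots> \<le> card I + k"
      using I_max[OF gJ] card_mono[OF _ r] by simp
    finally show "card X \<le> n" using good_le[OF I] by (simp add: k_def)
  qed
  have "finite I" using I fin by (auto simp: good_def intro: finite_subset)
  then have pad_card: "card (Inl ` I \<union> Inr ` {..<k}) = n"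
    using card_split[of I "{..<k}"] good_le[OF I] by (simp add: k_def)
  then have "V' \<noteq> {}" using n I by (auto simp: V'_def good_def)
  have "Inl ` I \<union> Inr ` {..<k} \<subseteq> V'"
    using I by (auto simp: V'_def good_def)
  moreover have "inj_on cl' (Inl ` I \<union> Inr ` {..<k})"
  proof (rule inj_onI)
    fix u w assume "u \<in> Inl ` I \<union> Inr ` {..<k}" "w \<in> Inl ` I \<union> Inr ` {..<k}" "cl' u = cl' w"
    then show "u = w" using I unfolding good_def cl'_def by (auto dest: inj_onD)
  qed
  moreover have "\<forall>u\<in>Inl ` I \<union> Inr ` {..<k}. \<forall>w\<in>Inl ` I \<union> Inr ` {..<k}. \<not> E' u w"
    using I by (auto simp: E' good_def)
  moreover have "finite V'" using fin by (simp add: V'_def)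
  ultimately obtain S' where S': "pad.dominates V' S'" "int (card S') \<le> h n"
    using pad.dominating_classes_of_tight_bound[OF h _ \<open>V' \<noteq> {}\<close> pad_bound _ _ _ pad_card]
    by blast
  have fin_S': "finite S'"
    using S'(1) fin by (auto simp: pad.dominates_def V'_def intro: finite_subset)
  have "S' \<noteq> {}" using S'(1) \<open>V' \<noteq> {}\<close> by (auto simp: pad.dominates_def)
  then have one: "1 \<le> card S'" using fin_S' by (simp add: Suc_le_eq card_gt_0_iff)
  define S where "S = (Inl -` S' :: 'b set)"
  have "card S \<le> card S'"
    using fin_S' by (intro card_inj_on_le[of Inl]) (auto simp: S_def)
  moreover have "dominates V S"
    unfolding dominates_def
  proof (intro conjI ballI)
    have "S' \<subseteq> cl' ` V'" using S'(1) unfolding pad.dominates_def by blast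
    then show "S \<subseteq> cl ` V" by (force simp: S_def V'_def cl'_def)
    fix y assume "y \<in> V"
    then have "cl' (Inl y) \<in> S' \<or> (\<exists>u\<in>V'. cl' u \<in> S' \<and> E' u (Inl y))"
      using S'(1) by (auto simp: pad.dominates_def V'_def)
    then show "cl y \<in> S \<or> (\<exists>x\<in>V. cl x \<in> S \<and> E x y)"
      by (auto simp: S_def cl'_def E' V'_def)
  qed
  ultimately show ?thesis using that S'(2) one by simp
qed


section \<open>Stars and components in colorings without rainbow triangles\<close>

locale gallai_coloring =
  fixes G :: "'a pair_pre_digraph" and col :: "'a set \<Rightarrow> 'c"
  assumes pair_graph_G: "pair_graph G" and no_rainbow: "no_rainbow_triangle G col"
begin

definition component :: "'c \<Rightarrow> 'a \<Rightarrow> 'a set" where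
  "component c v = pre_digraph.scc_of (with_proj (color_subgraph G col c)) v"

definition nbr :: "'a \<Rightarrow> 'a set" where
  "nbr v = {x. (v, x) \<in> parcs G}"

definition star_arc :: "'a \<Rightarrow> 'a \<Rightarrow> 'a \<Rightarrow> bool" where
  "star_arc v x y \<longleftrightarrow> x \<in> nbr v \<and> y \<in> nbr v \<and> (x, y) \<in> parcs G \<and>
     col {v, x} \<noteq> col {v, y} \<and> col {x, y} = col {v, x}"

text \<open>
  Subsets \<open>W\<close> of the vertices are covered by components of the whole graph \<open>G\<close>, so the induction
  can delete vertices from \<open>W\<close> without passing to an induced subgraph.
\<close>

definition coverable :: "'a set \<Rightarrow> nat \<Rightarrow> bool" where
  "coverable W k \<longleftrightarrow>
     (\<exists>\<C>. finite \<C> \<and> \<C> \<subseteq> monochromatic_components G col \<and> W \<subseteq> \<Union>\<C> \<and> card \<C> \<le> k)"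

definition independence_bound :: "'a set \<Rightarrow> nat \<Rightarrow> bool" where
  "independence_bound W n \<longleftrightarrow> (\<forall>I\<subseteq>W. independent_set G I \<longrightarrow> card I \<le> n)"

lemma arc_sym: "(x, y) \<in> parcs G \<Longrightarrow> (y, x) \<in> parcs G"
proof -
  interpret pair_graph G by (rule pair_graph_G)
  show "(x, y) \<in> parcs G \<Longrightarrow> (y, x) \<in> parcs G"
    using pair_sym_arcs by (auto simp: symmetric_def elim: symE)
qed

lemma no_loop: "(x, x) \<notin> parcs G"
proof -
  interpret pair_graph G by (rule pair_graph_G)
  show ?thesis using pair_no_loops by force
qed

lemma arc_in_verts: "(x, y) \<in> parcs G \<Longrightarrow> x \<in> pverts G \<and> y \<in> pverts G"
proof -
  interpret pair_graph G by (rule pair_graph_G)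
  show "(x, y) \<in> parcs G \<Longrightarrow> x \<in> pverts G \<and> y \<in> pverts G"
    using in_arcsD1 in_arcsD2 by blast
qed

lemma finite_pverts: "finite (pverts G)"
proof -
  interpret pair_graph G by (rule pair_graph_G)
  show ?thesis by (rule pair_finite_verts)
qed

lemma color_subgraph_sym: "pair_sym_digraph (color_subgraph G col c)"
proof
  fix e assume "e \<in> parcs (color_subgraph G col c)"
  then show "fst e \<in> pverts (color_subgraph G col c)" "snd e \<in> pverts (color_subgraph G col c)"
    using arc_in_verts by (auto simp: color_subgraph_def)
next
  show "symmetric (with_proj (color_subgraph G col c))"
    by (auto simp: symmetric_def color_subgraph_def insert_commute intro!: symI arc_sym)
qed

lemma component_is_monochromatic:
  assumes "v \<in> pverts G"
  shows "component c v \<in> monochromatic_components G col"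
proof -
  interpret C: pair_sym_digraph "color_subgraph G col c" by (rule color_subgraph_sym)
  have "component c v \<in> pre_digraph.sccs_verts (with_proj (color_subgraph G col c))"
    using assms C.scc_of_in_sccs_verts[of v] by (simp add: component_def color_subgraph_def)
  then show ?thesis by (auto simp: monochromatic_components_def)
qed

lemma component_self: "v \<in> pverts G \<Longrightarrow> v \<in> component c v"
proof -
  interpret C: pair_sym_digraph "color_subgraph G col c" by (rule color_subgraph_sym)
  show "v \<in> pverts G \<Longrightarrow> v \<in> component c v"
    using C.in_scc_of_self[of v] by (simp add: component_def color_subgraph_def)
qed

lemma component_step:
  assumes "y \<in> component c v" "(y, z) \<in> parcs G" "col {y, z} = c"
  shows "z \<in> component c v"
proof -
  let ?C = "with_proj (color_subgraph G col c)"
  interpret C: pair_sym_digraph "color_subgraph G col c" by (rule color_subgraph_sym)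
  have "(y, z) \<in> parcs (color_subgraph G col c)" "(z, y) \<in> parcs (color_subgraph G col c)"
    using assms arc_sym by (auto simp: color_subgraph_def insert_commute)
  then have "y \<rightarrow>\<^sup>*\<^bsub>?C\<^esub> z" "z \<rightarrow>\<^sup>*\<^bsub>?C\<^esub> y"
    by (auto intro!: C.reachable_adjI)
  then show ?thesis
    using assms(1) C.reachable_trans unfolding component_def C.scc_of_def by blast
qed

lemma star_triangle:
  assumes "x \<in> nbr v" "y \<in> nbr v" "(x, y) \<in> parcs G"
  shows "\<not> (col {v, x} \<noteq> col {x, y} \<and> col {x, y} \<noteq> col {v, y} \<and> col {v, x} \<noteq> col {v, y})"
  using assms no_rainbow unfolding no_rainbow_triangle_def nbr_def by blast

lemma star_adjacent:
  assumes "x \<in> nbr v" "y \<in> nbr v" "(x, y) \<in> parcs G" "col {v, x} \<noteq> col {v, y}"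
  shows "star_arc v x y \<or> star_arc v y x"
  using star_triangle[OF assms(1-3)] assms arc_sym[OF assms(3)]
  by (auto simp: star_arc_def insert_commute)

text \<open>
  The edges of a cyclic triangle \<open>x y z\<close> would have the colors of \<open>vx\<close>, \<open>vy\<close> and \<open>vz\<close>, which are
  pairwise distinct because the arcs join different classes.
\<close>

lemma star_triangle_free: "triangle_free_multipartite (star_arc v) (\<lambda>x. col {v, x})"
proof
  show "star_arc v x y \<Longrightarrow> col {v, x} \<noteq> col {v, y}" for x y by (simp add: star_arc_def)
  fix x y z assume a: "star_arc v x y" "star_arc v y z"
  show "\<not> star_arc v z x"
  proof
    assume "star_arc v z x"
    with a have "col {x, y} \<noteq> col {y, z} \<and> col {y, z} \<noteq> col {x, z} \<and> col {x, y} \<noteq> col {x, z}"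
      "(x, y) \<in> parcs G" "(y, z) \<in> parcs G" "(x, z) \<in> parcs G"
      using arc_sym by (auto simp: star_arc_def insert_commute)
    then show False using no_rainbow unfolding no_rainbow_triangle_def by blast
  qed
qed

text \<open>
  By \<open>star_adjacent\<close>, neighbours of \<open>v\<close> in different classes that are joined by an edge of \<open>G\<close> are
  also joined by an arc; so a transversal independent set of the star digraph is independent in \<open>G\<close>.
\<close>

lemma star_transversal_bound:
  assumes "independence_bound W n" "X \<subseteq> W \<inter> nbr v"
  shows "triangle_free_multipartite.transversal_bound (star_arc v) (\<lambda>x. col {v, x}) X n"
proof -
  interpret star: triangle_free_multipartite "star_arc v" "\<lambda>x. col {v, x}"
    by (rule star_triangle_free)
  show ?thesis
    unfolding star.transversal_bound_def
  proof (intro allI impI)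
    fix I assume I: "I \<subseteq> X" "inj_on (\<lambda>x. col {v, x}) I" "\<forall>x\<in>I. \<forall>y\<in>I. \<not> star_arc v x y"
    have "(x, y) \<notin> parcs G" if "x \<in> I" "y \<in> I" for x y
      using that I assms(2) star_adjacent[of x v y] no_loop[of x]
      by (auto simp: inj_on_def subset_iff)
    moreover have "I \<subseteq> pverts G" using I(1) assms(2) arc_in_verts by (auto simp: nbr_def)
    ultimately have "independent_set G I" by (auto simp: independent_set_def)
    then show "card I \<le> n" using assms I(1) by (auto simp: independence_bound_def)
  qed
qed

lemma independence_bound_nonneighbours:
  assumes "independence_bound W (Suc n)" "v \<in> W" "W \<subseteq> pverts G"
  shows "independence_bound (W - insert v (nbr v)) n"
  unfolding independence_bound_def
proof (intro allI impI)
  fix I assume I: "I \<subseteq> W - insert v (nbr v)" "independent_set G I"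
  then have "independent_set G (insert v I)"
    using assms(2,3) no_loop arc_sym by (auto simp: independent_set_def nbr_def)
  then have "card (insert v I) \<le> Suc n"
    using assms(1)[unfolded independence_bound_def, rule_format, of "insert v I"] assms(2) I(1)
    by blast
  moreover have "finite I" using I(2) finite_pverts
    by (auto simp: independent_set_def intro: finite_subset)
  moreover have "v \<notin> I" using I(1) by blast
  ultimately show "card I \<le> n" by simp
qed

text \<open>
  The components of \<open>v\<close> in the colors of \<open>S\<close> cover \<open>v\<close> and its neighbours in \<open>W\<close>: a dominated
  vertex \<open>y\<close> is reached from \<open>v\<close> by a path \<open>v x y\<close> in one color of \<open>S\<close>. The maximum with \<open>1\<close> provides a
  component for \<open>v\<close> itself when \<open>v\<close> has no neighbours in \<open>W\<close> and \<open>S\<close> is empty.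
\<close>

lemma coverable_via_star:
  assumes v: "v \<in> pverts G"
    and dom: "triangle_free_multipartite.dominates (star_arc v) (\<lambda>x. col {v, x}) (W \<inter> nbr v) S"
    and rest: "coverable (W - insert v (nbr v)) k"
  shows "coverable W (max 1 (card S) + k)"
proof -
  interpret star: triangle_free_multipartite "star_arc v" "\<lambda>x. col {v, x}"
    by (rule star_triangle_free)
  obtain \<C> where \<C>: "finite \<C>" "\<C> \<subseteq> monochromatic_components G col"
      "W - insert v (nbr v) \<subseteq> \<Union>\<C>" "card \<C> \<le> k"
    using rest by (auto simp: coverable_def)
  have "nbr v \<subseteq> pverts G" using arc_in_verts by (auto simp: nbr_def)
  then have "finite (W \<inter> nbr v)" using finite_pverts by (auto intro: finite_subset)
  then have "finite S"
    using dom unfolding star.dominates_def by (meson finite_imageI finite_subset)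
  define T where "T = (if S = {} then {undefined} else S)"
  have T: "finite T" "T \<noteq> {}" "S \<subseteq> T" "card T = max 1 (card S)"
    using \<open>finite S\<close> by (auto simp: T_def max_def Suc_le_eq card_gt_0_iff)
  define \<D> where "\<D> = (\<lambda>c. component c v) ` T"
  have own: "x \<in> component (col {v, x}) v" if "x \<in> nbr v" for x
    using component_step[OF component_self[OF v]] that by (auto simp: nbr_def)
  have "W \<subseteq> \<Union>(\<D> \<union> \<C>)"
  proof
    fix y assume y: "y \<in> W"
    consider "y = v" | "y \<in> W \<inter> nbr v" | "y \<in> W - insert v (nbr v)" using y by blast
    then show "y \<in> \<Union>(\<D> \<union> \<C>)"
    proof cases
      case 1
      then show ?thesis using component_self[OF v] T(2) by (auto simp: \<D>_def)
    next
      case 2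
      then consider "col {v, y} \<in> S" | x where "x \<in> nbr v" "col {v, x} \<in> S" "star_arc v x y"
        using dom by (auto simp: star.dominates_def)
      then show ?thesis
      proof cases
        case 1
        then show ?thesis using own[of y] 2 T(3) by (auto simp: \<D>_def)
      next
        case (2 x)
        then have "y \<in> component (col {v, x}) v"
          using component_step[OF own[OF 2(1)], of y] by (auto simp: star_arc_def)
        then show ?thesis using 2 T(3) by (auto simp: \<D>_def)
      qed
    next
      case 3
      then show ?thesis using \<C>(3) by auto
    qed
  qed
  moreover have "card (\<D> \<union> \<C>) \<le> max 1 (card S) + k"
    using card_Un_le[of \<D> \<C>] card_image_le[OF T(1), of "\<lambda>c. component c v"] \<C>(4) T(4)
    unfolding \<D>_def by linarith
  moreover have "\<D> \<union> \<C> \<subseteq> monochromatic_components G col" "finite (\<D> \<union> \<C>)"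
    using \<C> T(1) component_is_monochromatic[OF v] by (auto simp: \<D>_def)
  ultimately show ?thesis unfolding coverable_def by blast
qed

lemma coverable_mono: "coverable W k \<Longrightarrow> k \<le> l \<Longrightarrow> coverable W l"
  unfolding coverable_def by (meson le_trans)

lemma coverable_empty: "coverable {} k"
  by (auto simp: coverable_def intro!: exI[of _ "{}"])

lemma coverable_clique:
  assumes "independence_bound W 1" "W \<subseteq> pverts G"
  shows "coverable W 1"
proof (cases "W = {}")
  case False
  then obtain v where v: "v \<in> W" by blast
  interpret star: triangle_free_multipartite "star_arc v" "\<lambda>x. col {v, x}"
    by (rule star_triangle_free)
  have fin: "finite (W \<inter> nbr v)" using assms(2) finite_pverts by (auto intro: finite_subset)
  have sc: "star.semicomplete (W \<inter> nbr v)"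
    using star.semicomplete_if_transversal_bound_1 star_transversal_bound[OF assms(1)] by blast
  obtain S where S: "star.dominates (W \<inter> nbr v) S" "card S \<le> 1"
  proof (cases "W \<inter> nbr v = {}")
    case True
    then show ?thesis using that[of "{}"] by (auto simp: star.dominates_def)
  next
    case False
    then show ?thesis
      using star.semicomplete_dominating_class[OF fin False sc] that
      by (metis card_1_singleton_iff le_refl One_nat_def)
  qed
  have "independence_bound (W - insert v (nbr v)) 0"
    using independence_bound_nonneighbours[OF _ v assms(2)] assms(1) by simp
  then have "card {u} \<le> 0" if "u \<in> W - insert v (nbr v)" "independent_set G {u}" for u
    unfolding independence_bound_def using that(1) that(2) by (metis empty_subsetI insert_subset)
  moreover have "independent_set G {u}" if "u \<in> W" for u
    using that assms(2) no_loop by (auto simp: independent_set_def)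
  ultimately have "u \<notin> W - insert v (nbr v)" for u by (auto simp del: Diff_iff)
  then have "W - insert v (nbr v) = {}" by blast
  then have "coverable (W - insert v (nbr v)) 0" by (metis coverable_empty)
  then have "coverable W (max 1 (card S) + 0)"
    using coverable_via_star[OF _ S(1)] v assms(2) by blast
  then show ?thesis using S(2) by (simp add: max_def split: if_splits)
qed (simp add: coverable_empty)

lemma coverable_five:
  assumes "independence_bound W 2" "W \<subseteq> pverts G"
  shows "coverable W 5"
proof (cases "W = {}")
  case False
  then obtain v where v: "v \<in> W" by blast
  interpret star: triangle_free_multipartite "star_arc v" "\<lambda>x. col {v, x}"
    by (rule star_triangle_free)
  have fin: "finite (W \<inter> nbr v)" using assms(2) finite_pverts by (auto intro: finite_subset)
  obtain S where S: "star.dominates (W \<inter> nbr v) S" "card S \<le> 4"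
    using star.four_dominating_classes[OF fin star_transversal_bound[OF assms(1)]] by blast
  have "independence_bound (W - insert v (nbr v)) 1"
    using independence_bound_nonneighbours[OF _ v assms(2)] assms(1)
    by (simp add: numeral_2_eq_2)
  then have "coverable (W - insert v (nbr v)) 1" using coverable_clique assms(2) by blast
  then have "coverable W (max 1 (card S) + 1)"
    using coverable_via_star[OF _ S(1)] v assms(2) by blast
  moreover have "max 1 (card S) + 1 \<le> 5" using S(2) by simp
  ultimately show ?thesis by (rule coverable_mono)
qed (simp add: coverable_empty)

text \<open>
  The induction uses an upper bound \<open>n\<close> on the independence number of \<open>W\<close> and not its exact value,
  since deleting \<open>v\<close> and its neighbours may lower it by more than one.
\<close>

lemma coverable_by_recursion:
  fixes h g :: "nat \<Rightarrow> int"
  assumes h: "\<And>(D :: nat pair_pre_digraph) P.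
      multipartite_digraph D P \<Longrightarrow> \<not> has_cyclic_triangle D \<Longrightarrow>
      int (domination_number D P) \<le> h (transversal_independence_number D P)"
    and g1: "g 1 = 1"
    and g_rec: "\<And>\<alpha>. \<alpha> \<ge> 2 \<Longrightarrow> g \<alpha> = g (\<alpha> - 1) + h \<alpha>"
    and "n \<ge> 1" "independence_bound W n" "W \<subseteq> pverts G"
  shows "\<exists>k. coverable W k \<and> int k \<le> g n"
  using assms(4-6)
proof (induction n arbitrary: W rule: dec_induct)
  case base
  then show ?case using coverable_clique g1 by (intro exI[of _ 1]) auto
next
  case (step n)
  have g: "g (Suc n) = g n + h (Suc n)" using g_rec[of "Suc n"] step.hyps by simp
  have star_dom: "\<exists>S. triangle_free_multipartite.dominates (star_arc v) (\<lambda>x. col {v, x})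
      (W \<inter> nbr v) S \<and> max 1 (int (card S)) \<le> h (Suc n)" for v
  proof -
    have "finite (W \<inter> nbr v)" using step.prems finite_pverts by (auto intro: finite_subset)
    moreover have "triangle_free_multipartite.transversal_bound (star_arc v) (\<lambda>x. col {v, x})
        (W \<inter> nbr v) (Suc n)"
      using star_transversal_bound[OF step.prems(1)] by blast
    ultimately obtain S where "triangle_free_multipartite.dominates (star_arc v)
        (\<lambda>x. col {v, x}) (W \<inter> nbr v) S" "max 1 (int (card S)) \<le> h (Suc n)"
      using dominating_classes_of_bound[OF star_triangle_free h _ le_SucI[OF step.hyps(1)]]
      by metis
    then show ?thesis by blast
  qed
  show ?case
  proof (cases "W = {}")
    case True
    obtain k where "int k \<le> g n"
      using step.IH[of "{}"] by (auto simp: independence_bound_def)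
    moreover have "1 \<le> h (Suc n)" using star_dom by fastforce
    ultimately have "int 0 \<le> g (Suc n)" using g by simp
    then show ?thesis using True coverable_empty by blast
  next
    case False
    then obtain v where v: "v \<in> W" by blast
    obtain S where S: "triangle_free_multipartite.dominates (star_arc v) (\<lambda>x. col {v, x})
        (W \<inter> nbr v) S" "max 1 (int (card S)) \<le> h (Suc n)"
      using star_dom by blast
    obtain k where k: "coverable (W - insert v (nbr v)) k" "int k \<le> g n"
      using step.IH[of "W - insert v (nbr v)"] step.prems v independence_bound_nonneighbours
      by blast
    have "coverable W (max 1 (card S) + k)"
      using coverable_via_star[OF _ S(1) k(1)] v step.prems(2) by blast
    moreover have "int (max 1 (card S) + k) \<le> g (Suc n)" using S(2) k(2) g by linarith
    ultimately show ?thesis by blast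
  qed
qed

lemma independence_number_bounds:
  assumes "pverts G \<noteq> {}"
  shows "independence_bound (pverts G) (independence_number G)" "independence_number G \<ge> 1"
proof -
  have "finite {I. independent_set G I}"
    using finite_pverts
    by (auto simp: independent_set_def intro: finite_subset[of _ "Pow (pverts G)"])
  then have le: "card I \<le> independence_number G" if "independent_set G I" for I
    using that by (simp add: independence_number_def)
  then show "independence_bound (pverts G) (independence_number G)"
    by (simp add: independence_bound_def)
  obtain v where "v \<in> pverts G" using assms by blast
  then show "independence_number G \<ge> 1"
    using le[of "{v}"] no_loop by (auto simp: independent_set_def)
qed

end


section \<open>Covering by monochromatic components\<close>

(* The vertices of D are natural numbers: every finite digraph is isomorphic to such a one. *)
theorem theorem7:
  fixes h g :: "nat \<Rightarrow> int"
    and G :: "'a pair_pre_digraph"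
    and col :: "'a set \<Rightarrow> 'c"
  assumes h: "\<And>(D :: nat pair_pre_digraph) P.
      multipartite_digraph D P \<Longrightarrow> \<not> has_cyclic_triangle D \<Longrightarrow>
      int (domination_number D P) \<le> h (transversal_independence_number D P)"
    and g1: "g 1 = 1"
    and g_rec: "\<And>\<alpha>. \<alpha> \<ge> 2 \<Longrightarrow> g \<alpha> = g (\<alpha> - 1) + h \<alpha>"
    and graph: "pair_graph G" "pverts G \<noteq> {}"
    and gallai: "no_rainbow_triangle G col"
  shows "(\<exists>\<C>. monochromatic_cover G col \<C> \<and> int (card \<C>) \<le> g (independence_number G)) \<and>
         (independence_number G = 2 \<longrightarrow> (\<exists>\<C>. monochromatic_cover G col \<C> \<and> card \<C> \<le> 5))"
proof -
  interpret gallai_coloring G col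
    using graph(1) gallai by (rule gallai_coloring.intro)
  have cover: "coverable (pverts G) k \<longleftrightarrow>
      (\<exists>\<C>. monochromatic_cover G col \<C> \<and> card \<C> \<le> k)" for k
    by (auto simp: coverable_def monochromatic_cover_def)
  note \<alpha> = independence_number_bounds[OF graph(2)]
  obtain k where "coverable (pverts G) k" "int k \<le> g (independence_number G)"
    using coverable_by_recursion[OF h g1 g_rec \<alpha>(2,1)] by blast
  then have "\<exists>\<C>. monochromatic_cover G col \<C> \<and> int (card \<C>) \<le> g (independence_number G)"
    unfolding cover using of_nat_mono order_trans by blast
  moreover have "\<exists>\<C>. monochromatic_cover G col \<C> \<and> card \<C> \<le> 5" if "independence_number G = 2"
    using coverable_five[of "pverts G"] \<alpha>(1) that unfolding cover by simp
  ultimately show ?thesis by blast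
qed

end
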